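(* Let $0\ne\delta\in\mathbb{C}_\infty$ and let $\phi$ be a rank $2$ Drinfeld module over $\mathbb{C}_\infty$, $\phi_T=T+A\tau+B\tau^2$ with $B\ne0$, such that $B\delta^{q^2}+A\delta^q+T\delta=0$, $v(\jmath)<-q$ where $\jmath=A^{q+1}/B$, and $v(\delta)=\frac{v(A)-v(B)}{q^2-q}$. Fix a $(q-1)$-st root of $T/B$ and set $c:=\delta^{-1}(T/B)^{1/(q-1)}$. Let $\beta_j$ be the coefficients of $\log_\phi(z)=\sum_j\beta_jz^{q^j}$, and set \[\mathfrak{a}_\delta(n):=T\sum_{j=0}^n\beta_j\delta^{q^j},\qquad \mathfrak{f}(z):=\sum_{n=0}^\infty\mathfrak{a}_\delta(n)z^{q^n}.\] Then the series $\mathfrak{f}$ converges at $z=\delta^{-q}c$, and $\mathfrak{f}(\delta^{-q}c)$ is a nonzero period of $\Lambda_\phi$ of maximal valuation among the nonzero elements of $\Lambda_\phi$.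
   Context: $q$ is a prime power, $v$ the valuation on $\mathbb{F}_q(T)$ with $v(T)=-1$, extended to $\mathbb{C}_\infty$ (completion of an algebraic closure of the $v$-adic completion of $\mathbb{F}_q(T)$). $\tau$ is the $q$-Frobenius. The exponential $e_\phi(z)=z+\sum_{n\ge1}\alpha_nz^{q^n}$ is the entire function with $e_\phi(Tz)=Te_\phi(z)+Ae_\phi(z)^q+Be_\phi(z)^{q^2}$; $\log_\phi(z)=\sum\beta_nz^{q^n}$ ($\beta_0=1$) is its composition-inverse power series, characterized by $T\log_\phi(z)=\log_\phi(\phi_T(z))$. $\Lambda_\phi$ is the set of zeros of $e_\phi$ (the period lattice). *)

theory Defs
  imports
    "HOL-Library.Extended_Real"
    "HOL-Computational_Algebra.Polynomial"
    "HOL-Computational_Algebra.Formal_Power_Series"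
    "HOL-Analysis.Analysis"
begin

definition poly_over :: "'a::zero set \<Rightarrow> 'a poly \<Rightarrow> bool" where
  "poly_over K f \<longleftrightarrow> (\<forall>i. coeff f i \<in> K)"

text \<open>In an algebraically closed field whose characteristic divides the prime power \<open>q\<close>,
  the field with \<open>q\<close> elements is the set of fixed points of the \<open>q\<close>-Frobenius.\<close>

definition Fq :: "nat \<Rightarrow> 'a::field set" where
  "Fq q = {x. x ^ q = x}"

definition Fq_T :: "nat \<Rightarrow> 'a::field \<Rightarrow> 'a set" where
  "Fq_T q T = {poly f T / poly g T | f g.
     poly_over (Fq q) f \<and> poly_over (Fq q) g \<and> poly g T \<noteq> 0}"

definition algebraic_over :: "'a::field set \<Rightarrow> 'a \<Rightarrow> bool" where
  "algebraic_over K x \<longleftrightarrow> (\<exists>f. f \<noteq> 0 \<and> poly_over K f \<and> poly f x = 0)"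

text \<open>The type \<open>'a\<close> with \<open>T\<close> and \<open>v\<close> is the completion of an algebraic closure of the
  completion \<open>K\<close> of \<open>F\<^sub>q(T)\<close> at \<open>v\<close>. It is described up to isomorphism as a field that is
  complete for \<open>v\<close>, algebraically closed (as the completion is, by Krasner's lemma), and in
  which the elements algebraic over \<open>K\<close> are dense; here \<open>K\<close> is the topological closure of
  \<open>F\<^sub>q(T)\<close>. The ultrametric law and \<open>v T = -1\<close> already force \<open>v\<close> to be minus the degree on
  \<open>F\<^sub>q[T]\<close>, hence also that \<open>T\<close> is transcendental over \<open>F\<^sub>q\<close>. The base \<open>q\<close> in the metric
  is only a normalisation; the metric ties the topology of the type to \<open>v\<close>.\<close>

locale C_infty =
  fixes q :: nat
    and T :: "'a::{alg_closed_field, complete_space}"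
    and v :: "'a \<Rightarrow> ereal"
  assumes prime_char: "prime CHAR('a)"
    and q_power: "\<exists>k>0. q = CHAR('a) ^ k"
    and v_infty_iff: "\<And>x. v x = \<infinity> \<longleftrightarrow> x = 0"
    and v_not_minfty: "\<And>x. v x \<noteq> -\<infinity>"
    and v_mult: "\<And>x y. v (x * y) = v x + v y"
    and v_add: "\<And>x y. min (v x) (v y) \<le> v (x + y)"
    and v_T: "v T = -1"
    and dist_v: "\<And>x y. dist x y =
      (if x = y then 0 else real q powr (- real_of_ereal (v (x - y))))"
    and dense_algebraic: "closure {x. algebraic_over (closure (Fq_T q T)) x} = UNIV"

text \<open>The library's evaluation of formal power series needs a real normed algebra, which
  rules out positive characteristic.\<close>

definition fps_value :: "'a::{field, metric_space} fps \<Rightarrow> 'a \<Rightarrow> 'a" where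
  "fps_value f z = (\<Sum>n. fps_nth f n * z ^ n)"

definition fps_entire :: "'a::{field, metric_space} fps \<Rightarrow> bool" where
  "fps_entire f \<longleftrightarrow> (\<forall>z. summable (\<lambda>n. fps_nth f n * z ^ n))"

text \<open>\<open>e\<close> is the exponential of the Drinfeld module with \<open>\<phi>\<^sub>T = T + A \<tau> + B \<tau>\<^sup>2\<close>.\<close>

definition is_drinfeld_exp ::
  "nat \<Rightarrow> 'a::{field, metric_space} \<Rightarrow> 'a \<Rightarrow> 'a \<Rightarrow> 'a fps \<Rightarrow> bool" where
  "is_drinfeld_exp q T A B e \<longleftrightarrow>
     (\<forall>m. m \<notin> range (\<lambda>n. q ^ n) \<longrightarrow> fps_nth e m = 0) \<and>
     fps_nth e 1 = 1 \<and>
     fps_entire e \<and>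
     (\<forall>z. fps_value e (T * z) =
        T * fps_value e z + A * fps_value e z ^ q + B * fps_value e z ^ (q ^ 2))"

definition period_lattice :: "'a::{field, metric_space} fps \<Rightarrow> 'a set" where
  "period_lattice e = {z. fps_value e z = 0}"

text \<open>The logarithm \<open>\<Sum>j. \<beta>\<^sub>j z^(q^j)\<close> is the compositional inverse of the exponential \<open>e\<close>.\<close>

definition log_coeff :: "nat \<Rightarrow> 'a::field fps \<Rightarrow> nat \<Rightarrow> 'a" where
  "log_coeff q e j = fps_nth (fps_inv e) (q ^ j)"

definition frak_a :: "nat \<Rightarrow> 'a::field \<Rightarrow> 'a fps \<Rightarrow> 'a \<Rightarrow> nat \<Rightarrow> 'a" where
  "frak_a q T e \<delta> n = T * (\<Sum>j=0..n. log_coeff q e j * \<delta> ^ (q ^ j))"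

end

theory Submission
  imports Defs
begin

text \<open>
  Skew power series \<open>\<Sum>a\<^sub>n \<tau>\<^sup>n\<close> multiply by \<open>\<tau> a = a\<^sup>q \<tau>\<close>, which is composition of the
  \<open>q\<close>-linear power series \<open>\<Sum>a\<^sub>n z^(q^n)\<close>. Since
  \<open>e T = \<phi>\<^sub>T e\<close> and \<open>\<phi>\<^sub>T\<close> kills \<open>\<delta>\<close>, the skew series \<open>\<ff> = T log \<Sum>\<delta> \<tau>\<^sup>n\<close> satisfies
  \<open>e \<ff> = \<phi>\<^sub>T \<Sum>\<delta> \<tau>\<^sup>n = T \<delta> - B \<delta>^(q^2) \<tau>\<close>, and \<open>w = \<delta>^(-q) c\<close> is a root of the right-hand side. So
  \<open>e (\<ff> w) = 0\<close> once convergence is settled.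

  Put \<open>R = \<bar>T \<delta> w\<bar>\<close> and let \<open>\<alpha>\<^sub>n\<close> be the coefficients of \<open>e\<close>. The recursion
  \<open>(T^(q^n) - T) \<alpha>\<^sub>n = A \<alpha>\<^sub>n\<^sub>-\<^sub>1^q + B \<alpha>\<^sub>n\<^sub>-\<^sub>2^(q^2)\<close> yields \<open>\<bar>\<alpha>\<^sub>n\<bar> R^(q^n) \<le> R\<close>, so on \<open>\<bar>z\<bar> < R\<close>
  the linear term dominates \<open>e\<close> and every nonzero period has absolute value at least \<open>R\<close>.
  Rewriting \<open>\<ff> = log (T \<delta> - B \<delta>^(q^2) \<tau>)\<close> gives a first-order recursion for the coefficients of
  \<open>\<ff>\<close>, from which the \<open>n\<close>-th term of \<open>\<ff> w\<close> is at most \<open>R \<rho>^(q^n - 1)\<close> with \<open>\<rho> < 1\<close>. The term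
  for \<open>n = 0\<close> is \<open>T \<delta> w\<close>, hence \<open>\<bar>\<ff> w\<bar> = R\<close>.
\<close>

unbundle no vec_syntax
unbundle fps_syntax

section \<open>Skew power series\<close>

locale prime_power_char =
  fixes q :: nat and type :: "'a::field itself"
  assumes prime_CHAR: "prime CHAR('a)"
    and prime_power: "\<exists>k>0. q = CHAR('a) ^ k"
begin

definition skew :: "(nat \<Rightarrow> 'a) \<Rightarrow> (nat \<Rightarrow> 'a) \<Rightarrow> nat \<Rightarrow> 'a" where
  "skew a b n = (\<Sum>i\<le>n. a i * b (n - i) ^ (q ^ i))"

definition scal :: "'a \<Rightarrow> nat \<Rightarrow> 'a" where
  "scal x i = (if i = 0 then x else 0)"

text \<open>At most one summand is nonzero, and the range \<open>n \<le> m\<close> loses nothing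
  because \<open>n < q ^ n\<close>; no logarithm of \<open>m\<close> has to be named.\<close>

definition q_series :: "(nat \<Rightarrow> 'a) \<Rightarrow> 'a fps" where
  "q_series a = Abs_fps (\<lambda>m. \<Sum>n\<le>m. if q ^ n = m then a n else 0)"

section \<open>Frobenius powers and \<open>q\<close>-linear power series\<close>

lemma q_gt_1: "q > 1"
proof -
  obtain k where "k > 0" "q = CHAR('a) ^ k" using prime_power by blast
  then show ?thesis using prime_CHAR prime_gt_1_nat by (metis one_less_power)
qed

lemma q_power_CHAR: "\<exists>k. q ^ i = CHAR('a) ^ k"
  using prime_power by (metis power_mult)

lemma frobenius_add: "(x + y :: 'a) ^ (q ^ i) = x ^ (q ^ i) + y ^ (q ^ i)"
  using freshmans_dream'[OF prime_CHAR] q_power_CHAR by blast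

lemma frobenius_diff: "(x - y :: 'a) ^ (q ^ i) = x ^ (q ^ i) - y ^ (q ^ i)"
  using frobenius_add[of "x - y" y i] by simp

lemma frobenius_sum: "(sum f A :: 'a) ^ (q ^ i) = (\<Sum>x\<in>A. f x ^ (q ^ i))"
  using freshmans_dream_sum'[OF prime_CHAR] q_power_CHAR by blast

lemma q_power_eq_iff: "q ^ i = q ^ j \<longleftrightarrow> i = j"
  using q_gt_1 by simp

lemma less_q_power: "n < q ^ n"
  using q_gt_1 by (simp add: less_exp power_gt_expt)

lemma q_series_nth: "q_series a $ (q ^ n) = a n"
  using less_q_power[of n]
  by (simp add: q_series_def q_power_eq_iff if_distrib less_imp_le cong: if_cong)

lemma q_series_nth_eq_0: "m \<notin> range (\<lambda>n. q ^ n) \<Longrightarrow> q_series a $ m = 0"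
  by (auto simp: q_series_def intro!: sum.neutral)

lemma q_series_eqI:
  assumes "\<And>m. m \<notin> range (\<lambda>n. q ^ n) \<Longrightarrow> f $ m = 0"
  shows "f = q_series (\<lambda>n. f $ (q ^ n))"
proof (rule fps_ext)
  fix m show "f $ m = q_series (\<lambda>n. f $ (q ^ n)) $ m"
    by (cases "m \<in> range (\<lambda>n. q ^ n)") (auto simp: q_series_nth q_series_nth_eq_0 assms)
qed

text \<open>Frobenius is additive over finite sums, so \<open>b\<close> is cut after degree
  \<open>m\<close>. The rest is divisible by \<open>fps_X ^ Suc m\<close>, and its power starts only
  in degree \<open>Suc m * Q\<close>, beyond \<open>m\<close>.\<close>

lemma fps_power_q_power_nth:
  fixes b :: "'a fps"
  shows "b ^ (q ^ i) $ m = (if q ^ i dvd m then (b $ (m div q ^ i)) ^ (q ^ i) else 0)"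
proof -
  define Q where "Q = q ^ i"
  have Q: "Q > 0" using q_gt_1 by (simp add: Q_def)
  obtain k where k: "Q = CHAR('a) ^ k" using q_power_CHAR Q_def by blast
  have p: "prime CHAR('a fps)" using prime_CHAR by simp
  have cut: "fps_cutoff (Suc m) b = (\<Sum>j\<le>m. fps_const (b $ j) * fps_X ^ j)"
    by (rule fps_ext) (auto simp: fps_sum_nth mult_delta_right)
  have "b ^ Q = (fps_X ^ Suc m * fps_shift (Suc m) b + fps_cutoff (Suc m) b) ^ Q"
    by (simp only: fps_shift_cutoff')
  also have "\<dots> = (fps_X ^ Suc m * fps_shift (Suc m) b) ^ Q + fps_cutoff (Suc m) b ^ Q"
    using freshmans_dream'[OF p] k by simp
  also have "fps_cutoff (Suc m) b ^ Q = (\<Sum>j\<le>m. (fps_const (b $ j) * fps_X ^ j) ^ Q)"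
    unfolding cut using freshmans_dream_sum'[OF p] k by simp
  also have "\<dots> = (\<Sum>j\<le>m. fps_const ((b $ j) ^ Q) * fps_X ^ (j * Q))"
    by (simp add: power_mult_distrib power_mult)
  also have "(fps_X ^ Suc m * fps_shift (Suc m) b) ^ Q
      = fps_X ^ (Suc m * Q) * fps_shift (Suc m) b ^ Q"
    by (simp only: power_mult_distrib power_mult)
  finally have eq: "b ^ Q = fps_X ^ (Suc m * Q) * fps_shift (Suc m) b ^ Q
      + (\<Sum>j\<le>m. fps_const ((b $ j) ^ Q) * fps_X ^ (j * Q))" .
  have "m < Suc m * Q"
    using Q by (metis less_le_trans lessI mult.commute mult_le_mono1 nat_mult_1 Suc_leI One_nat_def)
  then have "b ^ Q $ m = (\<Sum>j\<le>m. if m = j * Q then (b $ j) ^ Q else 0)"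
    unfolding eq
    by (auto simp: fps_sum_nth mult_delta_right fps_X_power_mult_nth simp del: mult_Suc
        intro!: sum.cong)
  also have "\<dots> = (if Q dvd m then (b $ (m div Q)) ^ Q else 0)"
  proof (cases "Q dvd m")
    case True
    then have "(m = j * Q) = (j = m div Q)" for j using Q by auto
    then show ?thesis using True by simp
  qed (auto intro!: sum.neutral)
  finally show ?thesis by (simp add: Q_def)
qed

text \<open>Only the powers \<open>q ^ j\<close> of \<open>q_series b\<close> enter, and Frobenius
  on their coefficients is the twist in \<open>skew\<close>.\<close>

lemma q_series_compose: "q_series a oo q_series b = q_series (skew a b)"
proof (rule fps_ext)
  fix m
  let ?f = "\<lambda>i. q_series a $ i * q_series b ^ i $ m"
  have 0: "q_series b $ 0 = 0"
    by (rule q_series_nth_eq_0) (use q_gt_1 in auto)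
  have "(q_series a oo q_series b) $ m = sum ?f {0..m}"
    by (simp add: fps_compose_nth)
  \<comment> \<open>Neither index set contains the other. Exponents that are no power of
    \<open>q\<close> meet a zero coefficient of \<open>q_series a\<close>; for
    \<open>q ^ j > m\<close> the coefficient of degree \<open>m\<close> vanishes, by indivisibility
    if \<open>m > 0\<close> and as a constant term if \<open>m = 0\<close>.\<close>
  also have "\<dots> = sum ?f ((\<lambda>j. q ^ j) ` {..m})"
  proof (rule sum.mono_neutral_cong)
    fix i assume i: "i \<in> {0..m} - (\<lambda>j. q ^ j) ` {..m}"
    have "i \<notin> range (\<lambda>j. q ^ j)"
    proof
      assume "i \<in> range (\<lambda>j. q ^ j)"
      then obtain j where j: "i = q ^ j" by auto
      then have "j \<le> m" using i less_q_power[of j] by auto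
      then show False using i j by blast
    qed
    then show "?f i = 0" by (simp add: q_series_nth_eq_0)
  next
    fix i assume "i \<in> (\<lambda>j. q ^ j) ` {..m} - {0..m}"
    then obtain j where j: "i = q ^ j" "m < i" by auto
    show "?f i = 0"
      using j 0 dvd_imp_le[of "q ^ j" m] by (cases "m = 0") (auto simp: fps_power_q_power_nth)
  qed auto
  also have "\<dots> = (\<Sum>j\<le>m. a j * q_series b ^ (q ^ j) $ m)"
    by (subst sum.reindex) (auto simp: inj_on_def q_power_eq_iff q_series_nth)
  also have "\<dots> = q_series (skew a b) $ m"
  proof (cases "m \<in> range (\<lambda>n. q ^ n)")
    case True
    then obtain n where n: "m = q ^ n" by auto
    have "(\<Sum>j\<le>m. a j * q_series b ^ (q ^ j) $ m) = (\<Sum>j\<le>n. a j * b (n - j) ^ (q ^ j))"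
    proof (rule sum.mono_neutral_cong_right)
      show "\<forall>j\<in>{..m} - {..n}. a j * q_series b ^ (q ^ j) $ m = 0"
        using q_gt_1 by (auto simp: fps_power_q_power_nth n dest!: power_dvd_imp_le)
      fix j assume "j \<in> {..n}"
      then have "q ^ j dvd q ^ n" "q ^ n div q ^ j = q ^ (n - j)"
        using q_gt_1 by (auto simp: le_imp_power_dvd power_diff)
      then show "a j * q_series b ^ (q ^ j) $ m = a j * b (n - j) ^ (q ^ j)"
        by (simp add: fps_power_q_power_nth n q_series_nth)
    qed (use less_q_power[of n] n in auto)
    then show ?thesis by (simp add: n q_series_nth skew_def)
  next
    case False
    have "q_series b ^ (q ^ j) $ m = 0" for j
    proof (cases "q ^ j dvd m")
      case True
      have "m div q ^ j \<notin> range (\<lambda>n. q ^ n)"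
      proof
        assume "m div q ^ j \<in> range (\<lambda>n. q ^ n)"
        then obtain n where "m div q ^ j = q ^ n" by auto
        then have "m = q ^ (j + n)"
          using True by (metis dvd_mult_div_cancel power_add)
        then show False using False by blast
      qed
      then show ?thesis using q_gt_1 by (simp add: fps_power_q_power_nth q_series_nth_eq_0)
    qed (simp add: fps_power_q_power_nth)
    then show ?thesis using False by (simp add: q_series_nth_eq_0)
  qed
  finally show "(q_series a oo q_series b) $ m = q_series (skew a b) $ m" .
qed

lemma q_series_inject: "q_series a = q_series b \<longleftrightarrow> a = b"
proof
  assume "q_series a = q_series b"
  then have "a n = b n" for n using q_series_nth[of a n] q_series_nth[of b n] by simp
  then show "a = b" ..
qed simp

text \<open>Inherited from composition of power series through the injection
  \<open>q_series\<close>.\<close>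

lemma skew_assoc: "skew (skew a b) c = skew a (skew b c)"
proof -
  have 0: "q_series f $ 0 = 0" for f
    by (rule q_series_nth_eq_0) (use q_gt_1 in auto)
  show ?thesis
    using fps_compose_assoc[OF 0 0, of "q_series a" b c]
    by (simp add: q_series_compose q_series_inject)
qed

lemma q_series_scal_1: "q_series (scal 1) = fps_X"
proof (rule fps_ext)
  fix m show "q_series (scal 1) $ m = fps_X $ m"
  proof (cases "m \<in> range (\<lambda>n. q ^ n)")
    case True
    then obtain n where n: "m = q ^ n" by auto
    show ?thesis
      using q_gt_1 by (cases n) (simp_all only: n q_series_nth scal_def, simp_all)
  next
    case False
    then have "m \<noteq> 1" by (metis power_0 rangeI)
    then show ?thesis using False by (simp add: q_series_nth_eq_0)
  qed
qed

lemma skew_scal_left: "skew (scal x) a = (\<lambda>n. x * a n)"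
proof
  fix n
  have "skew (scal x) a n = (\<Sum>i\<le>n. if i = 0 then x * a n else 0)"
    unfolding skew_def scal_def by (rule sum.cong) auto
  then show "skew (scal x) a n = x * a n" by simp
qed

lemma skew_scal_right: "skew a (scal x) = (\<lambda>n. a n * x ^ (q ^ n))"
proof
  fix n
  have "q \<noteq> 0" using q_gt_1 by simp
  then   have "skew a (scal x) n = (\<Sum>i\<le>n. if i = n then a n * x ^ (q ^ n) else 0)"
    unfolding skew_def scal_def using q_gt_1 by (intro sum.cong) (auto simp: power_0_left)
  then show "skew a (scal x) n = a n * x ^ (q ^ n)" by simp
qed

section \<open>Inversion of skew series\<close>

fun left_inv :: "(nat \<Rightarrow> 'a) \<Rightarrow> nat \<Rightarrow> 'a" where
  "left_inv a n = (if n = 0 then 1 else - (\<Sum>i<n. left_inv a i * a (n - i) ^ (q ^ i)))"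

declare left_inv.simps [simp del]

lemma skew_left_inv: assumes "a 0 = 1" shows "skew (left_inv a) a = scal 1"
proof
  fix n show "skew (left_inv a) a n = scal 1 n"
  proof (cases n)
    case 0 then show ?thesis using assms by (simp add: skew_def scal_def left_inv.simps)
  next
    case (Suc m)
    have "skew (left_inv a) a n = (\<Sum>i<n. left_inv a i * a (n - i) ^ (q ^ i)) + left_inv a n"
      using assms by (simp add: skew_def flip: lessThan_Suc_atMost)
    also have "\<dots> = 0" using Suc by (subst (2) left_inv.simps) simp
    finally show ?thesis using Suc by (simp add: scal_def)
  qed
qed

text \<open>Both sides are left inverses of \<open>q_series a\<close>, and composing on the right
  with a series without constant term and with nonzero linear term is injective.\<close>

lemma fps_inv_q_series:
  assumes "a 0 = 1"
  shows "fps_inv (q_series a) = q_series (left_inv a)"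
proof -
  have 0: "q_series a $ 0 = 0" by (rule q_series_nth_eq_0) (use q_gt_1 in auto)
  have 1: "q_series a $ 1 \<noteq> 0" using assms q_series_nth[of a 0] by simp
  have "q_series (left_inv a) oo q_series a = fps_inv (q_series a) oo q_series a"
    by (simp add: q_series_compose skew_left_inv[of a, OF assms] q_series_scal_1 fps_inv[OF 0 1])
  then show ?thesis by (simp only: fps_compose_inj_right[OF 0 1])
qed

lemma skew_right_inv: assumes "a 0 = 1" shows "skew a (left_inv a) = scal 1"
proof -
  have 0: "q_series a $ 0 = 0" by (rule q_series_nth_eq_0) (use q_gt_1 in auto)
  have 1: "q_series a $ 1 \<noteq> 0" using assms q_series_nth[of a 0] by simp
  have "q_series (skew a (left_inv a)) = q_series (scal 1)"
    using fps_inv_right[OF 0 1]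
    by (simp add: fps_inv_q_series[of a, OF assms] q_series_compose q_series_scal_1)
  then show ?thesis by (simp add: q_series_inject)
qed

text \<open>The finite form of evaluating a composite: the terms with \<open>i + j \<le> n\<close>
  are grouped by \<open>i\<close>, and Frobenius is pulled out of the inner sum. The truncation
  \<open>n - i\<close> makes the identity exact, so that limits can be taken afterwards.\<close>

lemma skew_sum:
  "(\<Sum>k\<le>n. skew a b k * z ^ (q ^ k)) = (\<Sum>i\<le>n. a i * (\<Sum>j\<le>n - i. b j * z ^ (q ^ j)) ^ (q ^ i))"
proof -
  have "(\<Sum>k\<le>n. skew a b k * z ^ (q ^ k))
      = (\<Sum>k\<le>n. \<Sum>i\<le>k. a i * (b (k - i) * z ^ (q ^ (k - i))) ^ (q ^ i))"
    unfolding skew_def sum_distrib_right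
    by (intro sum.cong refl) (simp add: power_mult_distrib mult.assoc flip: power_mult power_add)
  also have "\<dots> = (\<Sum>(i, j)\<in>{(i, j). i + j \<le> n}. a i * (b j * z ^ (q ^ j)) ^ (q ^ i))"
    by (simp add: sum.triangle_reindex_eq)
  also have "\<dots> = (\<Sum>(i, j)\<in>(SIGMA i:{..n}. {..n - i}). a i * (b j * z ^ (q ^ j)) ^ (q ^ i))"
    by (rule sum.cong) auto
  also have "\<dots> = (\<Sum>i\<le>n. \<Sum>j\<le>n - i. a i * (b j * z ^ (q ^ j)) ^ (q ^ i))"
    by (simp add: sum.Sigma)
  finally show ?thesis by (simp add: frobenius_sum sum_distrib_left)
qed

end

sublocale C_infty \<subseteq> prime_power_char q "TYPE('a)"
  using prime_char q_power by unfold_locales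

section \<open>The absolute value\<close>

context C_infty
begin

definition N :: "'a \<Rightarrow> real" where "N x = dist x 0"

lemma N_0 [simp]: "N 0 = 0"
  by (simp add: N_def)

lemma N_eq_0_iff [simp]: "N x = 0 \<longleftrightarrow> x = 0"
  by (simp add: N_def)

lemma N_nonneg [simp]: "N x \<ge> 0"
  by (simp add: N_def)

lemma N_pos_iff [simp]: "N x > 0 \<longleftrightarrow> x \<noteq> 0"
  by (simp add: N_def)

lemma dist_N: "dist x y = N (x - y)"
  by (simp add: N_def dist_v)

lemma v_real: "x \<noteq> 0 \<Longrightarrow> v x = ereal (real_of_ereal (v x))"
  using v_infty_iff[of x] v_not_minfty[of x] by (cases "v x") auto

lemma N_powr: "x \<noteq> 0 \<Longrightarrow> N x = real q powr (- real_of_ereal (v x))"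
  by (simp add: N_def dist_v)

lemma v_le_iff:
  assumes "x \<noteq> 0" "y \<noteq> 0"
  shows "v x \<le> v y \<longleftrightarrow> N y \<le> N x"
proof -
  have "v x \<le> v y \<longleftrightarrow> ereal (real_of_ereal (v x)) \<le> ereal (real_of_ereal (v y))"
    using v_real assms by metis
  also have "\<dots> \<longleftrightarrow> N y \<le> N x"
    using assms q_gt_1 by (simp add: N_powr)
  finally show ?thesis .
qed

lemma N_mult: "N (x * y) = N x * N y"
proof (cases "x = 0 \<or> y = 0")
  case False
  then have "real_of_ereal (v (x * y)) = real_of_ereal (v x) + real_of_ereal (v y)"
    using v_real[of x] v_real[of y] by (metis plus_ereal.simps(1) real_of_ereal.simps(1) v_mult)
  then show ?thesis using False by (simp add: N_powr algebra_simps flip: powr_add)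
qed auto

lemma N_1 [simp]: "N 1 = 1"
  using N_mult[of 1 1] by (metis N_eq_0_iff mult.right_neutral mult_cancel_left zero_neq_one)

lemma N_power: "N (x ^ n) = N x ^ n"
  by (induction n) (simp_all add: N_mult)

lemma N_minus [simp]: "N (- x) = N x"
proof -
  have "N (- 1) ^ 2 = 1"
    by (simp flip: N_power)
  then have "N (- 1) = 1"
    using N_nonneg[of "- 1"] by (simp add: power2_eq_1_iff)
  then show ?thesis using N_mult[of "- 1" x] by simp
qed

lemma N_inverse: "N (inverse x) = inverse (N x)"
  using N_mult[of x "inverse x"]
  by (cases "x = 0") (auto simp: field_simps)

lemma N_divide: "N (x / y) = N x / N y"
  by (simp add: divide_inverse N_mult N_inverse)

lemma N_add_le: "N (x + y) \<le> max (N x) (N y)"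
proof (cases "x = 0 \<or> y = 0 \<or> x + y = 0")
  case True
  then show ?thesis by (auto simp: le_max_iff_disj)
next
  case False
  then have "v x \<le> v (x + y) \<or> v y \<le> v (x + y)"
    using v_add[of x y] by (auto simp: min_le_iff_disj)
  then show ?thesis using False by (auto simp: v_le_iff le_max_iff_disj)
qed

lemma N_add_bound: "N x \<le> K \<Longrightarrow> N y \<le> K \<Longrightarrow> N (x + y) \<le> K"
  using N_add_le[of x y] by simp

lemma N_diff_bound: "N x \<le> K \<Longrightarrow> N y \<le> K \<Longrightarrow> N (x - y) \<le> K"
  using N_add_bound[of x K "- y"] by simp

lemma N_sum_bound:
  assumes "\<And>i. i \<in> A \<Longrightarrow> N (f i) \<le> K" "0 \<le> K"
  shows "N (sum f A) \<le> K"
  using assms by (induction A rule: infinite_finite_induct) (auto intro: N_add_bound)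

lemma N_add_dominant:
  assumes "N y < N x"
  shows "N (x + y) = N x"
proof (rule antisym)
  show "N (x + y) \<le> N x" using assms by (intro N_add_bound) auto
  show "N x \<le> N (x + y)"
    using N_add_le[of "x + y" "- y"] assms by auto
qed

lemma N_T: "N T = real q"
proof -
  have "T \<noteq> 0" using v_T v_infty_iff[of T] by (auto simp: one_ereal_def)
  then show ?thesis using v_T q_gt_1 by (simp add: N_powr)
qed

section \<open>Limits and series in the ultrametric topology\<close>

lemma tendsto_iff_N: "(X \<longlongrightarrow> L) F \<longleftrightarrow> ((\<lambda>n. N (X n - L)) \<longlongrightarrow> 0) F"
  by (simp add: tendsto_dist_iff[of X] dist_N)

lemma tendsto_N: "(X \<longlongrightarrow> L) F \<Longrightarrow> ((\<lambda>n. N (X n)) \<longlongrightarrow> N L) F"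
  unfolding N_def by (intro tendsto_intros)

lemma tendsto_N_add:
  fixes X Y :: "'b \<Rightarrow> 'a"
  assumes "(X \<longlongrightarrow> L) F" "(Y \<longlongrightarrow> M) F"
  shows "((\<lambda>n. X n + Y n) \<longlongrightarrow> L + M) F"
  unfolding tendsto_iff_N
proof (rule tendsto_sandwich[OF _ _ tendsto_const])
  show "((\<lambda>n. N (X n - L) + N (Y n - M)) \<longlongrightarrow> 0) F"
    using assms tendsto_add[of "\<lambda>n. N (X n - L)" 0 F "\<lambda>n. N (Y n - M)" 0]
    by (simp add: tendsto_iff_N)
  show "\<forall>\<^sub>F n in F. N (X n + Y n - (L + M)) \<le> N (X n - L) + N (Y n - M)"
  proof (intro always_eventually allI)
    fix n
    have "N ((X n - L) + (Y n - M)) \<le> N (X n - L) + N (Y n - M)"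
      by (rule N_add_bound) auto
    then show "N (X n + Y n - (L + M)) \<le> N (X n - L) + N (Y n - M)"
      by (simp add: algebra_simps)
  qed
qed auto

lemma tendsto_N_cmult:
  fixes X :: "'b \<Rightarrow> 'a"
  assumes "(X \<longlongrightarrow> L) F"
  shows "((\<lambda>n. c * X n) \<longlongrightarrow> c * L) F"
  using tendsto_mult[OF tendsto_const[of "N c"] assms[unfolded tendsto_iff_N]]
  by (simp add: tendsto_iff_N N_mult flip: right_diff_distrib)

lemma tendsto_N_diff:
  fixes X Y :: "'b \<Rightarrow> 'a"
  assumes "(X \<longlongrightarrow> L) F" "(Y \<longlongrightarrow> M) F"
  shows "((\<lambda>n. X n - Y n) \<longlongrightarrow> L - M) F"
  using tendsto_N_add[OF assms(1) tendsto_N_cmult[OF assms(2), of "-1"]] by simp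

lemma tendsto_N_frobenius:
  fixes X :: "'b \<Rightarrow> 'a"
  assumes "(X \<longlongrightarrow> L) F"
  shows "((\<lambda>n. X n ^ (q ^ i)) \<longlongrightarrow> L ^ (q ^ i)) F"
  using tendsto_power[OF assms[unfolded tendsto_iff_N], of "q ^ i"] q_gt_1
  by (simp add: tendsto_iff_N N_power power_0_left flip: frobenius_diff)

lemma N_le_of_tendsto:
  assumes "X \<longlonglongrightarrow> L" "\<And>n. n \<ge> n0 \<Longrightarrow> N (X n) \<le> K"
  shows "N L \<le> K"
  using tendsto_N[OF assms(1)] assms(2)
  by (intro tendsto_upperbound[of "\<lambda>n. N (X n)" "N L" sequentially K])
     (auto simp: eventually_sequentially)

lemma tendsto_0_of_N_le:
  assumes "\<And>n. N (X n) \<le> g n" "g \<longlonglongrightarrow> 0"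
  shows "X \<longlonglongrightarrow> 0"
  unfolding tendsto_iff_N
  by (rule tendsto_sandwich[OF _ _ tendsto_const assms(2)]) (use assms(1) in auto)

text \<open>In a complete ultrametric field null terms suffice: a block \<open>sum f {m..<n}\<close>
  is no larger than its largest term.\<close>

lemma summableI_N:
  fixes f :: "nat \<Rightarrow> 'a"
  assumes "f \<longlonglongrightarrow> 0"
  shows "summable f"
proof -
  have "Cauchy (\<lambda>n. \<Sum>i<n. f i)"
    unfolding Cauchy_altdef
  proof (intro allI impI)
    fix e :: real assume e: "e > 0"
    have "(\<lambda>n. N (f n)) \<longlonglongrightarrow> 0" using assms by (simp add: tendsto_iff_N)
    then have "eventually (\<lambda>n. N (f n) < e / 2) sequentially"
      using e by (intro order_tendstoD(2)) auto
    then obtain M where M: "\<And>n. n \<ge> M \<Longrightarrow> N (f n) < e / 2"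
      by (auto simp: eventually_sequentially)
    show "\<exists>M. \<forall>m\<ge>M. \<forall>n>m. dist (\<Sum>i<m. f i) (\<Sum>i<n. f i) < e"
    proof (intro exI allI impI)
      fix m n assume mn: "M \<le> m" "m < n"
      have "(\<Sum>i<n. f i) - (\<Sum>i<m. f i) = sum f {m..<n}"
        using mn sum_diff_nat_ivl[of 0 m n f] by (simp add: atLeast0LessThan)
      then have "dist (\<Sum>i<m. f i) (\<Sum>i<n. f i) = N (sum f {m..<n})"
        by (metis dist_N dist_commute)
      also have "\<dots> \<le> e / 2"
        by (rule N_sum_bound) (use M mn e in \<open>auto intro: less_imp_le\<close>)
      finally show "dist (\<Sum>i<m. f i) (\<Sum>i<n. f i) < e" using e by simp
    qed
  qed
  then have "convergent (\<lambda>n. \<Sum>i<n. f i)"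
    by (rule Cauchy_convergent)
  then show ?thesis by (simp add: summable_iff_convergent)
qed

lemma partial_sums_tendsto:
  fixes f :: "nat \<Rightarrow> 'a"
  assumes "summable f"
  shows "(\<lambda>n. \<Sum>i\<le>n. f i) \<longlonglongrightarrow> suminf f"
proof -
  have "(\<lambda>n. \<Sum>i<n. f i) \<longlonglongrightarrow> suminf f"
    using assms by (simp add: summable_LIMSEQ)
  then show ?thesis
    by (auto dest: LIMSEQ_Suc simp: lessThan_Suc_atMost)
qed

lemma terms_tendsto_0:
  fixes f :: "nat \<Rightarrow> 'a"
  assumes "(\<lambda>n. \<Sum>i\<le>n. f i) \<longlonglongrightarrow> L"
  shows "f \<longlonglongrightarrow> 0"
proof -
  have "(\<lambda>n. (\<Sum>i\<le>Suc n. f i) - (\<Sum>i\<le>n. f i)) \<longlonglongrightarrow> L - L"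
    by (intro tendsto_N_diff assms LIMSEQ_Suc[OF assms])
  then show ?thesis by (simp add: filterlim_sequentially_Suc)
qed

lemma N_sums_dominant:
  fixes f :: "nat \<Rightarrow> 'a"
  assumes "(\<lambda>n. \<Sum>i\<le>n. f i) \<longlonglongrightarrow> L" and "K < N (f 0)"
    and "\<And>i. i > 0 \<Longrightarrow> N (f i) \<le> K"
  shows "N L = N (f 0)"
proof -
  have K: "0 \<le> K" using assms(3)[of 1] N_nonneg[of "f 1"] by linarith
  have "N (\<Sum>i\<le>n. f i) = N (f 0)" for n
  proof -
    have "N (\<Sum>i\<in>{0<..n}. f i) \<le> K" using assms(3) K by (intro N_sum_bound) auto
    then have "N (f 0 + (\<Sum>i\<in>{0<..n}. f i)) = N (f 0)"
      using assms(2) by (intro N_add_dominant) linarith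
    moreover have "{..n} = insert 0 {0<..n}" by auto
    ultimately show ?thesis by simp
  qed
  then show ?thesis
    using tendsto_N[OF assms(1)] by (simp add: LIMSEQ_const_iff)
qed

text \<open>At a sufficiently small \<open>z \<noteq> 0\<close> the first nonvanishing term
  outweighs all later ones, so the partial sums keep a fixed positive absolute value and cannot tend
  to \<open>0\<close>.\<close>

lemma coeffs_eq_0:
  fixes c :: "nat \<Rightarrow> 'a"
  assumes "\<And>z. (\<lambda>n. \<Sum>k\<le>n. c k * z ^ (q ^ k)) \<longlonglongrightarrow> 0"
  shows "c k = 0"
proof (induction k rule: less_induct)
  case (less k)
  show ?case
  proof (rule ccontr)
    assume ck: "c k \<noteq> 0"
    \<comment> \<open>Convergence at \<open>z = 1\<close> bounds all coefficients by one constant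
      \<open>K\<close>.\<close>
    have "c \<longlonglongrightarrow> 0"
      using terms_tendsto_0[OF assms[of 1]] by simp
    then have "convergent (\<lambda>n. N (c n))"
      using tendsto_N convergent_def by blast
    then have "Bseq (\<lambda>n. N (c n))" by (rule convergent_imp_Bseq)
    then obtain K where K: "K > 0" "\<And>n. N (c n) \<le> K"
      unfolding Bseq_def by auto
    have q: "1 / real q < 1" using q_gt_1 by simp
    have "\<exists>m. (1 / real q) ^ m < N (c k) / K"
      using real_arch_pow_inv[of "N (c k) / K" "1 / real q"] K ck q by auto
    then obtain m where m: "(1 / real q) ^ m < N (c k) / K" by auto
    define z where "z = inverse T ^ m"
    have Nz: "N z = (1 / real q) ^ m"
      by (simp add: z_def N_power N_divide N_T inverse_eq_divide)
    have z: "0 < N z" "N z \<le> 1" "K * N z < N (c k)"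
      using q_gt_1 m K unfolding Nz by (auto intro: power_le_one simp: field_simps)
    define d where "d = N (c k * z ^ (q ^ k))"
    have d: "d > 0" using ck z by (simp add: d_def)
    have "N (\<Sum>j\<le>n. c j * z ^ (q ^ j)) = d" if "n \<ge> k" for n
    proof -
      have "(\<Sum>j\<le>n. c j * z ^ (q ^ j)) = (\<Sum>j\<in>insert k {k<..n}. c j * z ^ (q ^ j))"
        using that less.IH by (intro sum.mono_neutral_right) auto
      also have "\<dots> = c k * z ^ (q ^ k) + (\<Sum>j\<in>{k<..n}. c j * z ^ (q ^ j))"
        by (subst sum.insert) auto
      finally have split: "(\<Sum>j\<le>n. c j * z ^ (q ^ j))
          = c k * z ^ (q ^ k) + (\<Sum>j\<in>{k<..n}. c j * z ^ (q ^ j))" .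
      \<comment> \<open>Every later exponent is at least \<open>q ^ k + 1\<close>; the spare factor
        \<open>N z\<close> absorbs \<open>K\<close>, since \<open>K * N z < N (c k)\<close>.\<close>
      have "N (\<Sum>j\<in>{k<..n}. c j * z ^ (q ^ j)) \<le> K * N z ^ Suc (q ^ k)"
      proof (rule N_sum_bound)
        fix j assume "j \<in> {k<..n}"
        then have "Suc (q ^ k) \<le> q ^ j" using q_gt_1 by (simp add: Suc_le_eq)
        then have "N z ^ q ^ j \<le> N z ^ Suc (q ^ k)"
          using z by (intro power_decreasing) auto
        then show "N (c j * z ^ (q ^ j)) \<le> K * N z ^ Suc (q ^ k)"
          unfolding N_mult N_power using K by (intro mult_mono) auto
      qed (use K in auto)
      also have "\<dots> = (K * N z) * N z ^ (q ^ k)" by simp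
      also have "\<dots> < N (c k) * N z ^ (q ^ k)"
        using z by (intro mult_strict_right_mono) auto
      finally have "N (\<Sum>j\<in>{k<..n}. c j * z ^ (q ^ j)) < N (c k * z ^ (q ^ k))"
        by (simp add: N_mult N_power)
      then show ?thesis unfolding split d_def by (rule N_add_dominant)
    qed
    then have "eventually (\<lambda>n. N (\<Sum>j\<le>n. c j * z ^ (q ^ j)) = d) sequentially"
      by (auto simp: eventually_sequentially)
    then have "(\<lambda>n. N (\<Sum>j\<le>n. c j * z ^ (q ^ j))) \<longlonglongrightarrow> d"
      by (rule tendsto_eventually)
    moreover have "(\<lambda>n. N (\<Sum>j\<le>n. c j * z ^ (q ^ j))) \<longlonglongrightarrow> 0"
      using tendsto_N[OF assms[of z]] by simp
    ultimately show False using d LIMSEQ_unique by force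
  qed
qed

end

section \<open>The fundamental period\<close>

text \<open>The last two assumptions concern the isomorphic Drinfeld module for which \<open>\<delta>\<close> becomes \<open>1\<close>:
  its coefficients \<open>A \<delta>^(q-1)\<close> and \<open>B \<delta>^(q^2-1)\<close> have the same absolute value, larger than \<open>\<bar>T\<bar>\<close>.\<close>

locale drinfeld_period = C_infty q T v
  for q :: nat and T :: "'a::{alg_closed_field, complete_space}" and v :: "'a \<Rightarrow> ereal" +
  fixes A B \<delta> w :: 'a and e :: "'a fps"
  assumes drinfeld_exp: "is_drinfeld_exp q T A B e"
    and delta_nonzero: "\<delta> \<noteq> 0"
    and delta_torsion: "B * \<delta> ^ (q ^ 2) + A * \<delta> ^ q + T * \<delta> = 0"
    and w_torsion: "w ^ (q - 1) * (B * \<delta> ^ (q ^ 2 - 1)) = T"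
    and N_A: "N A * N \<delta> ^ (q - 1) = N B * N \<delta> ^ (q ^ 2 - 1)"
    and N_B: "real q < N B * N \<delta> ^ (q ^ 2 - 1)"
begin

definition \<alpha> :: "nat \<Rightarrow> 'a" where "\<alpha> n = e $ (q ^ n)"

definition \<phi> :: "nat \<Rightarrow> 'a" where
  "\<phi> i = (if i = 0 then T else if i = 1 then A else if i = 2 then B else 0)"

definition R :: real where "R = N (T * \<delta> * w)"

definition \<rho> :: real where "\<rho> = max (N w) (1 / real q)"

definition F :: "nat \<Rightarrow> 'a" where "F n = frak_a q T e \<delta> n * w ^ (q ^ n)"

section \<open>The exponential as a skew series\<close>

lemma alpha_0: "\<alpha> 0 = 1"
  using drinfeld_exp by (simp add: \<alpha>_def is_drinfeld_exp_def)

lemma exp_eq_q_series: "e = q_series \<alpha>"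
  unfolding \<alpha>_def [abs_def]
  by (rule q_series_eqI) (use drinfeld_exp in \<open>auto simp: is_drinfeld_exp_def\<close>)

lemma log_coeff_eq: "log_coeff q e n = left_inv \<alpha> n"
proof -
  have "fps_inv e = q_series (left_inv \<alpha>)"
    using fps_inv_q_series[of \<alpha>, OF alpha_0] exp_eq_q_series by simp
  then show ?thesis by (simp add: log_coeff_def q_series_nth)
qed

text \<open>Only exponents \<open>q ^ i\<close> carry a term, so cutting the full series after
  degree \<open>q ^ n\<close> leaves the sum over \<open>i \<le> n\<close>; these cuts form a
  subsequence of the partial sums.\<close>

lemma exp_tendsto: "(\<lambda>n. \<Sum>i\<le>n. \<alpha> i * z ^ (q ^ i)) \<longlonglongrightarrow> fps_value e z"
proof -
  have "(\<lambda>n. \<Sum>k<n. e $ k * z ^ k) \<longlonglongrightarrow> fps_value e z"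
    using drinfeld_exp unfolding is_drinfeld_exp_def fps_entire_def fps_value_def
    by (simp add: summable_LIMSEQ)
  moreover have "strict_mono (\<lambda>n. Suc (q ^ n))"
    using q_gt_1 by (simp add: strict_mono_def)
  ultimately have "((\<lambda>n. \<Sum>k<n. e $ k * z ^ k) \<circ> (\<lambda>n. Suc (q ^ n))) \<longlonglongrightarrow> fps_value e z"
    by (rule LIMSEQ_subseq_LIMSEQ)
  moreover have "(\<Sum>k<Suc (q ^ n). e $ k * z ^ k) = (\<Sum>i\<le>n. \<alpha> i * z ^ (q ^ i))" for n
  proof -
    have "(\<Sum>k<Suc (q ^ n). e $ k * z ^ k) = (\<Sum>k\<in>(\<lambda>i. q ^ i) ` {..n}. e $ k * z ^ k)"
    proof (rule sum.mono_neutral_right)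
      show "(\<lambda>i. q ^ i) ` {..n} \<subseteq> {..<Suc (q ^ n)}"
        using q_gt_1 by (auto simp: less_Suc_eq_le)
      show "\<forall>k\<in>{..<Suc (q ^ n)} - (\<lambda>i. q ^ i) ` {..n}. e $ k * z ^ k = 0"
      proof
        fix k assume k: "k \<in> {..<Suc (q ^ n)} - (\<lambda>i. q ^ i) ` {..n}"
        have "k \<notin> range (\<lambda>i. q ^ i)"
          using k q_gt_1 by (auto simp: less_Suc_eq_le)
        then have "e $ k = 0"
          using exp_eq_q_series q_series_nth_eq_0 by metis
        then show "e $ k * z ^ k = 0" by simp
      qed
    qed auto
    also have "\<dots> = (\<Sum>i\<le>n. \<alpha> i * z ^ (q ^ i))"
      by (subst sum.reindex) (auto simp: inj_on_def q_power_eq_iff \<alpha>_def)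
    finally show ?thesis .
  qed
  ultimately show ?thesis by (simp add: o_def)
qed

lemma sum_phi:
  "(\<Sum>i\<le>Suc (Suc n). \<phi> i * h i) = T * h 0 + A * h 1 + B * h 2"
proof -
  have "(\<Sum>i\<le>Suc (Suc n). \<phi> i * h i) = (\<Sum>i\<in>{0, 1, 2}. \<phi> i * h i)"
    by (rule sum.mono_neutral_right) (auto simp: \<phi>_def)
  also have "\<dots> = T * h 0 + A * h 1 + B * h 2" by (simp add: \<phi>_def add.assoc)
  finally show ?thesis .
qed

lemma skew_phi_0: "skew \<phi> b 0 = T * b 0"
  by (simp add: skew_def \<phi>_def)

lemma skew_phi_1: "skew \<phi> b (Suc 0) = T * b 1 + A * b 0 ^ q"
  by (simp add: skew_def \<phi>_def)

lemma skew_phi_Suc_Suc: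
  "skew \<phi> b (Suc (Suc n)) = T * b (Suc (Suc n)) + A * b (Suc n) ^ q + B * b n ^ (q ^ 2)"
  unfolding skew_def sum_phi by (simp add: numeral_2_eq_2)

text \<open>By the functional equation of \<open>e\<close>, the \<open>q\<close>-linear series
  formed from the difference of both sides vanishes at every point; hence so do its
  coefficients.\<close>

lemma skew_exp: "skew \<phi> \<alpha> = skew \<alpha> (scal T)"
proof
  fix k
  define c where "c k = skew \<phi> \<alpha> k - skew \<alpha> (scal T) k" for k
  define P where "P n z = (\<Sum>i\<le>n. \<alpha> i * z ^ (q ^ i))" for n z
  \<comment> \<open>The shift \<open>m\<close> takes the values 2, 1, 0: cutting the product at
    \<open>n + 2\<close> leaves, under the \<open>i\<close>-th Frobenius, the partial sum up to
    \<open>n + 2 - i\<close>.\<close>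
  have P: "(\<lambda>n. P (n + m) z) \<longlonglongrightarrow> fps_value e z" for z m
    using LIMSEQ_ignore_initial_segment[OF exp_tendsto] by (simp add: P_def)
  have "c k = 0"
  proof (rule coeffs_eq_0)
    fix z
    have eq: "(\<Sum>k\<le>n + 2. c k * z ^ (q ^ k))
        = T * P (n + 2) z + A * P (n + 1) z ^ (q ^ 1) + B * P (n + 0) z ^ (q ^ 2) - P (n + 2) (T * z)" for n
    proof -
      have "(\<Sum>k\<le>n + 2. skew \<phi> \<alpha> k * z ^ (q ^ k))
          = (\<Sum>i\<le>Suc (Suc n). \<phi> i * P (Suc (Suc n) - i) z ^ (q ^ i))"
        by (simp add: skew_sum P_def)
      also have "\<dots> = T * P (n + 2) z + A * P (n + 1) z ^ (q ^ 1) + B * P (n + 0) z ^ (q ^ 2)"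
        unfolding sum_phi by (simp add: numeral_2_eq_2)
      finally have 1: "(\<Sum>k\<le>n + 2. skew \<phi> \<alpha> k * z ^ (q ^ k)) = \<dots>" .
      have 2: "(\<Sum>k\<le>n + 2. skew \<alpha> (scal T) k * z ^ (q ^ k)) = P (n + 2) (T * z)"
        by (simp add: skew_scal_right P_def power_mult_distrib mult.assoc)
      show ?thesis
        unfolding 1[symmetric] 2[symmetric] c_def by (simp add: left_diff_distrib sum_subtractf)
    qed
    have "(\<lambda>n. \<Sum>k\<le>n + 2. c k * z ^ (q ^ k)) \<longlonglongrightarrow>
        T * fps_value e z + A * fps_value e z ^ (q ^ 1) + B * fps_value e z ^ (q ^ 2)
          - fps_value e (T * z)"
      unfolding eq
      by (intro tendsto_N_diff tendsto_N_add tendsto_N_cmult tendsto_N_frobenius P)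
    also have "T * fps_value e z + A * fps_value e z ^ (q ^ 1) + B * fps_value e z ^ (q ^ 2)
          - fps_value e (T * z) = 0"
      using drinfeld_exp by (simp add: is_drinfeld_exp_def)
    finally show "(\<lambda>n. \<Sum>k\<le>n. c k * z ^ (q ^ k)) \<longlonglongrightarrow> 0"
      by (rule LIMSEQ_offset)
  qed
  then show "skew \<phi> \<alpha> k = skew \<alpha> (scal T) k" by (simp add: c_def)
qed

section \<open>The exponential applied to the series \<open>frak_a\<close>\<close>

definition g :: "nat \<Rightarrow> 'a" where
  "g i = (if i = 0 then T * \<delta> else if i = 1 then - B * \<delta> ^ (q ^ 2) else 0)"

lemma frak_a_eq_skew: "frak_a q T e \<delta> = skew (scal T) (skew (left_inv \<alpha>) (\<lambda>_. \<delta>))"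
  by (rule ext) (simp add: frak_a_def log_coeff_eq skew_scal_left skew_def atLeast0AtMost)

lemma skew_exp_frak_a: "skew \<alpha> (frak_a q T e \<delta>) = g"
proof -
  have "skew \<alpha> (frak_a q T e \<delta>) = skew \<phi> (skew (skew \<alpha> (left_inv \<alpha>)) (\<lambda>_. \<delta>))"
    unfolding frak_a_eq_skew by (metis skew_assoc skew_exp)
  also have "\<dots> = skew \<phi> (\<lambda>_. \<delta>)"
    by (simp add: skew_right_inv[of \<alpha>, OF alpha_0] skew_scal_left)
  also have "\<dots> = g"
  proof
    fix n
    \<comment> \<open>From degree 2 on the coefficient is the full torsion relation, hence 0; in
      degree 1 its term with \<open>B\<close> is missing, which leaves the negative of that
      term.\<close>
    consider "n = 0" | "n = Suc 0" | m where "n = Suc (Suc m)" by (metis not0_implies_Suc)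
    then show "skew \<phi> (\<lambda>_. \<delta>) n = g n"
      using delta_torsion
      by cases (auto simp: skew_phi_0 skew_phi_1 skew_phi_Suc_Suc g_def algebra_simps
          eq_neg_iff_add_eq_0)
  qed
  finally show ?thesis .
qed

text \<open>As \<open>g\<close> has only two nonzero coefficients, each \<open>frak_a\<close> is
  expressed through at most two logarithm coefficients instead of all up to
  \<open>n\<close>.\<close>

lemma frak_a_eq: "frak_a q T e \<delta> = skew (left_inv \<alpha>) g"
proof -
  have "skew (left_inv \<alpha>) g = skew (skew (left_inv \<alpha>) \<alpha>) (frak_a q T e \<delta>)"
    by (simp add: skew_assoc skew_exp_frak_a)
  also have "\<dots> = frak_a q T e \<delta>"
    by (simp add: skew_left_inv[of \<alpha>, OF alpha_0] skew_scal_left)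
  finally show ?thesis by simp
qed

section \<open>Absolute values of \<open>w\<close> and of the exponential coefficients\<close>

lemma N_w_power: "N w ^ (q - 1) * (N B * N \<delta> ^ (q ^ 2 - 1)) = real q"
  using arg_cong[OF w_torsion, of N] by (simp add: N_mult N_power N_T)

lemma w_nonzero: "w \<noteq> 0"
  using N_w_power q_gt_1 by (auto simp: power_0_left)

lemma N_w_power_less_1: "N w ^ (q - 1) < 1"
proof (rule ccontr)
  assume "\<not> N w ^ (q - 1) < 1"
  then have "1 * (N B * N \<delta> ^ (q ^ 2 - 1)) \<le> real q"
    unfolding N_w_power[symmetric] by (intro mult_right_mono) auto
  then show False using N_B by simp
qed

lemma N_w_less_1: "N w < 1"
  using N_w_power_less_1 one_le_power[of "N w" "q - 1"] by linarith

lemma rho: "0 < \<rho>" "\<rho> < 1"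
  using N_w_less_1 w_nonzero q_gt_1 by (auto simp: \<rho>_def less_max_iff_disj)

lemma R_eq: "R = real q * N \<delta> * N w"
  by (simp add: R_def N_mult N_T)

lemma R_pos: "R > 0"
  using w_nonzero delta_nonzero q_gt_1 by (simp add: R_eq)

text \<open>Together with \<open>N_B_R\<close> this bounds the terms with \<open>A\<close> and
  \<open>B\<close> at radius \<open>R\<close> by \<open>q ^ (q ^ i) * R\<close> for
  \<open>i = 1, 2\<close>. Dividing by \<open>T ^ (q ^ n) - T\<close> in the recursion for
  \<open>\<alpha>\<close> compensates this, as \<open>i \<le> n\<close>.\<close>

lemma N_A_R: "N A * R ^ q = real q ^ q * R"
proof -
  have q: "q = Suc (q - 1)" using q_gt_1 by simp
  have "N A * R ^ (q - 1) = (N A * N \<delta> ^ (q - 1)) * N w ^ (q - 1) * real q ^ (q - 1)"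
    by (simp add: R_eq power_mult_distrib)
  also have "\<dots> = real q * real q ^ (q - 1)"
    unfolding N_A using N_w_power by (simp only: mult.commute)
  also have "\<dots> = real q ^ q"
    by (subst (4) q) simp
  finally show ?thesis by (subst q) (simp add: mult.assoc)
qed

lemma N_B_R: "N B * R ^ (q ^ 2) \<le> real q ^ (q ^ 2) * R"
proof -
  have q2: "q ^ 2 = Suc (q ^ 2 - 1)" using q_gt_1 by simp
  \<comment> \<open>Of the two resulting factors of \<open>N w ^ (q ^ 2 - 1)\<close>, the first
    combines with \<open>B\<close> to \<open>q\<close> by \<open>N_w_power\<close>, and the second
    is at most 1.\<close>
  have q3: "q ^ 2 - 1 = (q - 1) + (q - 1) * q"
    using q_gt_1 by (simp add: power2_eq_square algebra_simps)
  have Nw: "N w ^ (q ^ 2 - 1) = N w ^ (q - 1) * (N w ^ (q - 1)) ^ q"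
    by (simp only: q3 power_add power_mult)
  have "N B * R ^ (q ^ 2 - 1)
      = (N w ^ (q - 1) * (N B * N \<delta> ^ (q ^ 2 - 1))) * real q ^ (q ^ 2 - 1) * (N w ^ (q - 1)) ^ q"
    by (simp add: R_eq power_mult_distrib Nw del: One_nat_def)
  also have "\<dots> \<le> real q * real q ^ (q ^ 2 - 1) * 1"
    unfolding N_w_power using N_w_less_1 by (intro mult_left_mono power_le_one) auto
  also have "\<dots> = real q ^ (q ^ 2)" by (subst (2) q2) simp
  finally have "N B * R ^ (q ^ 2 - 1) * R \<le> real q ^ (q ^ 2) * R"
    using R_pos by (intro mult_right_mono) auto
  then show ?thesis by (subst q2) (simp add: mult_ac)
qed

lemma N_T_power_diff: "n > 0 \<Longrightarrow> N (T ^ (q ^ n) - T) = real q ^ (q ^ n)"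
  using N_add_dominant[of "- T" "T ^ (q ^ n)"] q_gt_1 one_less_power[of q n]
    power_strict_increasing[of 1 "q ^ n" "real q"]
  by (simp add: N_T N_power)

lemma N_alpha: "N (\<alpha> n) * R ^ (q ^ n) \<le> R"
proof (induction n rule: less_induct)
  case (less n)
  show ?case
  proof (cases "n = 0")
    case True then show ?thesis by (simp add: alpha_0)
  next
    case False
    then obtain m where m: "n = Suc m" using not0_implies_Suc by blast
    \<comment> \<open>The coefficient of degree \<open>n\<close> in \<open>skew_exp\<close>;
      subtracting \<open>T * \<alpha> n\<close> leaves only the terms with \<open>A\<close> and
      \<open>B\<close> on the right.\<close>
    have rec: "(T ^ (q ^ n) - T) * \<alpha> n = skew \<phi> \<alpha> n - T * \<alpha> n"
      by (simp add: skew_exp skew_scal_right algebra_simps)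
    \<comment> \<open>One estimate serves \<open>A\<close> with \<open>i = 1\<close> and
      \<open>B\<close> with \<open>i = 2\<close>: as \<open>k + i = n\<close>, the factor
      \<open>R ^ (q ^ n)\<close> turns \<open>\<alpha> k ^ (q ^ i)\<close> into the
      \<open>q ^ i\<close>-th power of the inductive quantity.\<close>
    have step: "N c * N (\<alpha> k ^ (q ^ i)) * R ^ (q ^ n) \<le> real q ^ (q ^ n) * R"
      if "k + i = n" "i > 0" "N c * R ^ (q ^ i) \<le> real q ^ (q ^ i) * R" for c k i
    proof -
      have "N c * N (\<alpha> k ^ (q ^ i)) * R ^ (q ^ n) = N c * (N (\<alpha> k) * R ^ (q ^ k)) ^ (q ^ i)"
        by (simp add: N_power power_mult_distrib power_add flip: that(1) power_mult)
      also have "\<dots> \<le> N c * R ^ (q ^ i)"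
        using less.IH[of k] that R_pos by (intro mult_left_mono power_mono) auto
      also have "\<dots> \<le> real q ^ (q ^ i) * R" by (fact that)
      also have "\<dots> \<le> real q ^ (q ^ n) * R"
        using that q_gt_1 R_pos by (intro mult_right_mono power_increasing) auto
      finally show ?thesis .
    qed
    have A: "N (A * \<alpha> m ^ q) * R ^ (q ^ n) \<le> real q ^ (q ^ n) * R"
      using step[of m 1 A] N_A_R by (simp add: m N_mult)
    have "N (skew \<phi> \<alpha> n - T * \<alpha> n) * R ^ (q ^ n) \<le> real q ^ (q ^ n) * R"
    proof (cases m)
      case 0
      then show ?thesis using A by (simp add: m skew_phi_1)
    next
      case (Suc l)
      have "N (B * \<alpha> l ^ (q ^ 2)) * R ^ (q ^ n) \<le> real q ^ (q ^ n) * R"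
        using step[of l 2 B] N_B_R by (simp add: m Suc N_mult)
      then have "N (A * \<alpha> m ^ q + B * \<alpha> l ^ (q ^ 2)) \<le> real q ^ (q ^ n) * R / R ^ (q ^ n)"
        using A R_pos by (intro N_add_bound) (auto simp: field_simps)
      then have "N (A * \<alpha> m ^ q + B * \<alpha> l ^ (q ^ 2)) * R ^ (q ^ n) \<le> real q ^ (q ^ n) * R"
        using R_pos by (simp add: field_simps)
      then show ?thesis by (simp add: m Suc skew_phi_Suc_Suc add.assoc)
    qed
    then have "real q ^ (q ^ n) * (N (\<alpha> n) * R ^ (q ^ n)) \<le> real q ^ (q ^ n) * R"
      unfolding rec[symmetric] using False by (simp add: N_mult N_T_power_diff mult.assoc)
    then show ?thesis using q_gt_1 by (simp add: mult_le_cancel_left_pos)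
  qed
qed

text \<open>The rescaled form of \<open>N_alpha\<close>, applied with \<open>s < 1\<close> to a
  supposedly short period and with a power of \<open>\<rho>\<close> to the tails of the
  series.\<close>

lemma N_alpha_power:
  assumes "N x \<le> R * s"
  shows "N (\<alpha> n * x ^ (q ^ n)) \<le> R * s ^ (q ^ n)"
proof -
  have s: "0 \<le> s" using assms R_pos N_nonneg[of x] zero_le_mult_iff[of R s] by linarith
  have "N (\<alpha> n * x ^ (q ^ n)) \<le> N (\<alpha> n) * (R * s) ^ (q ^ n)"
    unfolding N_mult N_power using assms by (intro mult_left_mono power_mono) auto
  also have "\<dots> = N (\<alpha> n) * R ^ (q ^ n) * s ^ (q ^ n)"
    by (simp add: power_mult_distrib)
  also have "\<dots> \<le> R * s ^ (q ^ n)"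
    using s N_alpha by (intro mult_right_mono) auto
  finally show ?thesis .
qed

lemma period_lower_bound:
  assumes "\<omega> \<in> period_lattice e" "\<omega> \<noteq> 0"
  shows "R \<le> N \<omega>"
proof (rule ccontr)
  assume "\<not> R \<le> N \<omega>"
  define s where "s = N \<omega> / R"
  have s: "0 < s" "s < 1" "N \<omega> = R * s"
    using R_pos assms \<open>\<not> R \<le> N \<omega>\<close> by (auto simp: s_def)
  have "N (fps_value e \<omega>) = N (\<alpha> 0 * \<omega> ^ (q ^ 0))"
  proof (rule N_sums_dominant[OF exp_tendsto])
    \<comment> \<open>\<open>R * s ^ 2\<close> separates the linear term, of size
      \<open>R * s\<close>, from all others, whose exponents \<open>q ^ i\<close> are at least
      2.\<close>
    show "R * s ^ 2 < N (\<alpha> 0 * \<omega> ^ (q ^ 0))"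
      using s R_pos by (simp add: alpha_0 power2_eq_square)
    fix i :: nat assume "i > 0"
    then have "s ^ (q ^ i) \<le> s ^ 2"
      using s q_gt_1 power_increasing[of 1 i q] by (intro power_decreasing) auto
    then show "N (\<alpha> i * \<omega> ^ (q ^ i)) \<le> R * s ^ 2"
      using N_alpha_power[of \<omega> s i] s R_pos by (smt (verit) mult_left_mono)
  qed
  then show False using assms by (simp add: period_lattice_def alpha_0)
qed

text \<open>The factor \<open>\<rho>\<close> on the left stands in for the exponent
  \<open>q ^ n - 1\<close>, so that no subtraction enters the induction.\<close>

lemma rho_N_F: "\<rho> * N (F n) \<le> R * \<rho> ^ (q ^ n)"
proof -
  define D where "D = N \<delta>"
  \<comment> \<open>Chosen so that \<open>N w * M = \<rho>\<close>. The maximum in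
    \<open>\<rho>\<close> gives \<open>M \<ge> 1\<close>, which makes powers of \<open>M\<close>
    increase, and \<open>1 / N w \<le> q * M\<close>, which controls \<open>b\<close>.\<close>
  define M where "M = \<rho> / N w"
  have Nw: "N w > 0" using w_nonzero by simp
  have M: "M \<ge> 1" "1 / (real q * N w) \<le> M"
    using Nw q_gt_1 by (auto simp: M_def \<rho>_def field_simps)
  define G where "G n = left_inv \<alpha> n * \<delta> ^ (q ^ n)" for n
  define S where "S n = (\<Sum>j\<le>n. G j)" for n
  \<comment> \<open>\<open>b * \<delta>\<close> is the coefficient of \<open>g\<close> in degree 1,
    as \<open>T * \<delta>\<close> is in degree 0.\<close>
  define b where "b = - B * \<delta> ^ (q ^ 2 - 1)"
  have frak: "frak_a q T e \<delta> n = T * S n" for n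
    by (simp add: frak_a_def S_def G_def log_coeff_eq atLeast0AtMost)
  have Nb: "N b \<le> (real q * M) ^ (q - 1) * real q"
  proof -
    have "N b * N w ^ (q - 1) = real q"
      using N_w_power by (simp add: b_def N_mult N_power mult_ac)
    then have "N b = real q * (1 / N w) ^ (q - 1)"
      using Nw by (simp add: field_simps)
    also have "\<dots> \<le> real q * (real q * M) ^ (q - 1)"
      using M(2) Nw q_gt_1 by (intro mult_left_mono power_mono) (auto simp: field_simps)
    finally show ?thesis by (simp add: mult.commute)
  qed
  have q: "q = Suc (q - 1)" using q_gt_1 by simp
  have Nb': "M * N b \<le> (real q * M) ^ q"
  proof -
    have "M * N b \<le> M * ((real q * M) ^ (q - 1) * real q)"
      using Nb M by (intro mult_left_mono) auto
    also have "\<dots> = (real q * M) ^ q"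
      by (subst (5) q) (simp add: mult_ac)
    finally show ?thesis .
  qed
  \<comment> \<open>Sum and summand are bounded together, since the recursion for
    \<open>G (Suc n)\<close> involves both \<open>S n\<close> and \<open>G n\<close>.\<close>
  have bound: "M * N (S n) \<le> D * M ^ (q ^ n) \<and> M * N (G n) \<le> D * M ^ (q ^ n)" for n
  proof (induction n)
    case 0
    then show ?case by (simp add: S_def G_def left_inv.simps D_def)
  next
    case (Suc n)
    \<comment> \<open>A second formula for \<open>T * S (Suc n)\<close>; comparison with
      \<open>S n + G (Suc n)\<close> isolates \<open>G (Suc n)\<close>.\<close>
    have "T * S (Suc n) = skew (left_inv \<alpha>) g (Suc n)"
      by (metis frak frak_a_eq)
    also have "\<dots> = (\<Sum>i\<in>{n, Suc n}. left_inv \<alpha> i * g (Suc n - i) ^ (q ^ i))"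
      unfolding skew_def using q_gt_1
      by (intro sum.mono_neutral_right) (auto simp: g_def power_0_left)
    also have "\<dots> = left_inv \<alpha> n * (b * \<delta>) ^ (q ^ n)
        + left_inv \<alpha> (Suc n) * (T * \<delta>) ^ (q ^ Suc n)"
    proof -
      have "\<delta> ^ (q ^ 2) = \<delta> ^ (q ^ 2 - 1) * \<delta>"
        using q_gt_1 by (metis power_minus_mult zero_less_power zero_less_one less_trans)
      then show ?thesis by (simp add: g_def b_def mult.assoc)
    qed
    finally have "T * S (Suc n) = b ^ (q ^ n) * G n + T ^ (q ^ Suc n) * G (Suc n)"
      by (simp add: G_def power_mult_distrib mult_ac)
    moreover have S_Suc: "S (Suc n) = S n + G (Suc n)"
      by (simp add: S_def)
    ultimately have rec: "(T ^ (q ^ Suc n) - T) * G (Suc n) = T * S n - b ^ (q ^ n) * G n"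
      by (simp add: algebra_simps)
    define K where "K = D * M ^ (q ^ Suc n)"
    define Q where "Q = real q ^ (q ^ Suc n)"
    have Q: "Q > 0" "real q \<le> Q"
      using q_gt_1 by (auto simp: Q_def intro: self_le_power)
    have D: "D \<ge> 0" by (simp add: D_def)
    have mono: "D * M ^ (q ^ n) \<le> K"
      unfolding K_def using M D q_gt_1 by (intro mult_left_mono power_increasing) auto
    have K: "K \<ge> 0" using M D by (simp add: K_def)
    have 1: "N (T * S n) \<le> Q * K / M"
    proof -
      have "M * N (T * S n) = real q * (M * N (S n))" by (simp add: N_mult N_T)
      also have "\<dots> \<le> Q * K"
        using Suc mono Q K M by (intro mult_mono) auto
      finally show ?thesis using M by (simp add: field_simps)
    qed
    have 2: "N (b ^ (q ^ n) * G n) \<le> Q * K / M"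
    proof -
      \<comment> \<open>The factor \<open>M ^ (q ^ n)\<close> pairs each \<open>N b\<close> with an
        \<open>M\<close>, as \<open>Nb'\<close> requires, and is cancelled again.\<close>
      have "M ^ (q ^ n) * (M * N (b ^ (q ^ n) * G n)) = (M * N b) ^ (q ^ n) * (M * N (G n))"
        by (simp add: N_mult N_power power_mult_distrib)
      also have "\<dots> \<le> ((real q * M) ^ q) ^ (q ^ n) * (D * M ^ (q ^ n))"
        using Suc M power_mono[OF Nb'] by (intro mult_mono[where d = "D * M ^ (q ^ n)"]) auto
      also have "\<dots> = M ^ (q ^ n) * (Q * K)"
        by (simp add: Q_def K_def power_mult_distrib mult_ac flip: power_mult)
      finally have "M * N (b ^ (q ^ n) * G n) \<le> Q * K"
        using M by (simp add: mult_le_cancel_left_pos)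
      then show ?thesis using M by (simp add: field_simps)
    qed
    have "Q * N (G (Suc n)) \<le> Q * (K / M)"
      using N_diff_bound[OF 1 2] unfolding rec[symmetric]
      by (simp add: N_mult N_T_power_diff Q_def del: power_Suc)
    then have G: "N (G (Suc n)) \<le> K / M"
      using Q by (simp only: mult_le_cancel_left_pos)
    have "N (S n) \<le> K / M"
      using Suc mono M by (simp add: field_simps)
    then have "N (S (Suc n)) \<le> K / M"
      unfolding S_Suc using G by (rule N_add_bound)
    with G show ?case using M by (simp add: K_def field_simps)
  qed
  have "\<rho> * N (F n) = real q * N w * N w ^ (q ^ n) * (M * N (S n))"
    using Nw by (simp add: F_def frak N_mult N_T N_power M_def)
  also have "\<dots> \<le> real q * N w * N w ^ (q ^ n) * (D * M ^ (q ^ n))"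
    using bound q_gt_1 by (intro mult_left_mono) auto
  also have "\<dots> = R * (N w * M) ^ (q ^ n)"
    by (simp add: R_eq D_def power_mult_distrib)
  also have "N w * M = \<rho>" using Nw by (simp add: M_def)
  finally show ?thesis .
qed

lemma N_F: "N (F n) \<le> R * \<rho> ^ (q ^ n - 1)"
proof -
  have "\<rho> ^ (q ^ n) = \<rho> * \<rho> ^ (q ^ n - 1)"
    using q_gt_1 by (metis power_minus_mult mult.commute zero_less_power zero_less_one less_trans)
  then show ?thesis
    using rho_N_F[of n] rho by (simp add: mult.left_commute mult_le_cancel_left_pos)
qed

text \<open>A bound uniform in \<open>m\<close>, from \<open>q ^ n \<le> q ^ m - 1\<close>; it
  governs both summability and the tails.\<close>

lemma N_F_le:
  assumes "n < m"
  shows "N (F m) \<le> R * \<rho> ^ (q ^ n)"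
proof -
  have "q ^ n \<le> q ^ m - 1"
    using assms q_gt_1 power_strict_increasing[of n m q] by linarith
  then have "\<rho> ^ (q ^ m - 1) \<le> \<rho> ^ (q ^ n)"
    using rho by (intro power_decreasing) auto
  then have "R * \<rho> ^ (q ^ m - 1) \<le> R * \<rho> ^ (q ^ n)"
    using R_pos by (intro mult_left_mono) auto
  then show ?thesis using N_F[of m] by linarith
qed

section \<open>Convergence of the series, its absolute value, and the vanishing of the exponential
  there\<close>

lemma bound_tendsto_0: "(\<lambda>n. R * \<rho> ^ (q ^ n)) \<longlonglongrightarrow> 0"
proof -
  have "strict_mono (\<lambda>n. q ^ n)" using q_gt_1 by (simp add: strict_mono_def)
  moreover have "(\<lambda>n. \<rho> ^ n) \<longlonglongrightarrow> 0" using rho by (intro LIMSEQ_power_zero) auto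
  ultimately have "(\<lambda>n. \<rho> ^ (q ^ n)) \<longlonglongrightarrow> 0"
    using LIMSEQ_subseq_LIMSEQ by (fastforce simp: o_def)
  then show ?thesis using tendsto_mult_right_zero by blast
qed

lemma summable_F: "summable F"
proof (rule summableI_N)
  have "(\<lambda>n. F (Suc n)) \<longlonglongrightarrow> 0"
    by (rule tendsto_0_of_N_le[OF N_F_le[OF lessI] bound_tendsto_0])
  then show "F \<longlonglongrightarrow> 0" by (simp add: filterlim_sequentially_Suc)
qed

lemma N_suminf_F: "N (suminf F) = R"
proof -
  have F0: "F 0 = T * \<delta> * w"
    by (simp add: F_def frak_a_def log_coeff_eq left_inv.simps)
  have "N (suminf F) = N (F 0)"
  proof (rule N_sums_dominant[OF partial_sums_tendsto[OF summable_F]])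
    show "R * \<rho> < N (F 0)" using R_pos rho by (simp add: F0 flip: R_def)
    show "N (F i) \<le> R * \<rho>" if "i > 0" for i using N_F_le[OF that] by simp
  qed
  then show ?thesis by (simp add: F0 R_def)
qed

lemma N_tail: "N (suminf F - (\<Sum>j\<le>n. F j)) \<le> R * \<rho> ^ (q ^ n)"
proof (rule N_le_of_tendsto)
  show "(\<lambda>m. (\<Sum>j\<le>m. F j) - (\<Sum>j\<le>n. F j)) \<longlonglongrightarrow> suminf F - (\<Sum>j\<le>n. F j)"
    by (intro tendsto_N_diff tendsto_const partial_sums_tendsto summable_F)
  fix m assume "m \<ge> n"
  then have "{..m} = {..n} \<union> {n<..m}" by auto
  then have "(\<Sum>j\<le>m. F j) = (\<Sum>j\<le>n. F j) + (\<Sum>j\<in>{n<..m}. F j)"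
    by (simp only:) (rule sum.union_disjoint, auto)
  moreover have "N (\<Sum>j\<in>{n<..m}. F j) \<le> R * \<rho> ^ (q ^ n)"
    using R_pos rho by (intro N_sum_bound N_F_le) auto
  ultimately show "N ((\<Sum>j\<le>m. F j) - (\<Sum>j\<le>n. F j)) \<le> R * \<rho> ^ (q ^ n)" by simp
qed

lemma g_w: "T * \<delta> * w + - B * \<delta> ^ (q ^ 2) * w ^ q = 0"
proof -
  have "\<delta> ^ (q ^ 2) = \<delta> ^ (q ^ 2 - 1) * \<delta>" "w ^ q = w ^ (q - 1) * w"
    using q_gt_1 by (metis power_minus_mult zero_less_power zero_less_one less_trans)+
  then have "B * \<delta> ^ (q ^ 2) * w ^ q = (w ^ (q - 1) * (B * \<delta> ^ (q ^ 2 - 1))) * \<delta> * w"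
    by (simp add: mult_ac)
  then show ?thesis unfolding w_torsion by simp
qed

text \<open>Evaluating \<open>skew_exp_frak_a\<close> by \<open>skew_sum\<close> gives an exact zero
  with truncated inner sums, because \<open>w\<close> is a root of \<open>g\<close>. Subtracting it
  replaces \<open>suminf F\<close> by tails; the tail after \<open>n - i\<close>, under the
  \<open>i\<close>-th Frobenius, contributes at most \<open>R * \<rho> ^ (q ^ n)\<close> for every
  \<open>i\<close>.\<close>

lemma exp_suminf_F: "fps_value e (suminf F) = 0"
proof -
  \<comment> \<open>Starting at \<open>Suc n\<close> keeps both coefficients of \<open>g\<close>
    inside the truncation.\<close>
  have "(\<lambda>n. \<Sum>i\<le>Suc n. \<alpha> i * suminf F ^ (q ^ i)) \<longlonglongrightarrow> 0"
  proof (rule tendsto_0_of_N_le[OF _ LIMSEQ_Suc[OF bound_tendsto_0]])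
    fix m
    define n where "n = Suc m"
    have "(\<Sum>i\<le>n. \<alpha> i * (\<Sum>j\<le>n - i. F j) ^ (q ^ i)) = (\<Sum>k\<le>n. g k * w ^ (q ^ k))"
      by (simp add: F_def skew_exp_frak_a flip: skew_sum)
    also have "\<dots> = (\<Sum>k\<in>{0, 1}. g k * w ^ (q ^ k))"
      by (rule sum.mono_neutral_right) (auto simp: g_def n_def)
    also have "\<dots> = 0" using g_w by (simp add: g_def)
    finally have 0: "(\<Sum>i\<le>n. \<alpha> i * (\<Sum>j\<le>n - i. F j) ^ (q ^ i)) = 0" .
    have "(\<Sum>i\<le>n. \<alpha> i * suminf F ^ (q ^ i))
        = (\<Sum>i\<le>n. \<alpha> i * suminf F ^ (q ^ i)) - (\<Sum>i\<le>n. \<alpha> i * (\<Sum>j\<le>n - i. F j) ^ (q ^ i))"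
      by (simp add: 0)
    also have "\<dots> = (\<Sum>i\<le>n. \<alpha> i * (suminf F - (\<Sum>j\<le>n - i. F j)) ^ (q ^ i))"
      by (simp add: frobenius_diff right_diff_distrib sum_subtractf)
    also have "N \<dots> \<le> R * \<rho> ^ (q ^ n)"
    proof (rule N_sum_bound)
      fix i assume i: "i \<in> {..n}"
      have "N (\<alpha> i * (suminf F - (\<Sum>j\<le>n - i. F j)) ^ (q ^ i)) \<le> R * (\<rho> ^ (q ^ (n - i))) ^ (q ^ i)"
        by (rule N_alpha_power[OF N_tail])
      also have "(\<rho> ^ (q ^ (n - i))) ^ (q ^ i) = \<rho> ^ (q ^ n)"
        using i by (simp flip: power_mult power_add)
      finally show "N (\<alpha> i * (suminf F - (\<Sum>j\<le>n - i. F j)) ^ (q ^ i)) \<le> R * \<rho> ^ (q ^ n)" .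
    qed (use R_pos rho in auto)
    finally show "N (\<Sum>i\<le>Suc m. \<alpha> i * suminf F ^ (q ^ i)) \<le> R * \<rho> ^ (q ^ Suc m)"
      by (simp only: n_def)
  qed
  then show ?thesis
    using LIMSEQ_Suc[OF exp_tendsto] LIMSEQ_unique by blast
qed

end

section \<open>The hypotheses on valuations in multiplicative form\<close>

theorem theorem6p3:
  fixes q :: nat
    and T A B \<delta> r c :: "'a::{alg_closed_field, complete_space}"
    and v :: "'a \<Rightarrow> ereal"
    and e :: "'a fps"
  assumes "C_infty q T v"
    and "\<delta> \<noteq> 0"
    and "B \<noteq> 0"
    and "is_drinfeld_exp q T A B e"
    and "B * \<delta> ^ (q ^ 2) + A * \<delta> ^ q + T * \<delta> = 0"
    and "v (A ^ (q + 1) / B) < - ereal (real q)"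
    and "v \<delta> = (v A - v B) / ereal (real q ^ 2 - real q)"
    and "r ^ (q - 1) = T / B"
    and "c = inverse \<delta> * r"
  defines "f \<equiv> \<lambda>z. \<Sum>n. frak_a q T e \<delta> n * z ^ (q ^ n)"
    and "w \<equiv> inverse (\<delta> ^ q) * c"
  shows "summable (\<lambda>n. frak_a q T e \<delta> n * w ^ (q ^ n)) \<and>
    f w \<in> period_lattice e - {0} \<and>
    (\<forall>\<omega> \<in> period_lattice e - {0}. v \<omega> \<le> v (f w))"
proof -
  interpret C_infty q T v by fact
  define x where "x y = real_of_ereal (v y)" for y
  have Nx: "N y = real q powr (- x y)" if "y \<noteq> 0" for y
    using that by (simp add: N_powr x_def)
  have vx: "v y = ereal (x y)" if "y \<noteq> 0" for y
    using v_real[OF that] by (simp add: x_def)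
  have A0: "A \<noteq> 0"
    using assms(6) q_gt_1 v_infty_iff[of 0] by auto
  have qq: "real q ^ 2 - real q > 0"
    using q_gt_1 by (simp add: power2_eq_square)
  have xd: "x \<delta> * (real q ^ 2 - real q) = x A - x B"
    using assms(7) qq by (simp add: vx A0 assms(2,3) field_simps)
  have N_quot: "N (A ^ (q + 1) / B) > real q ^ q"
  proof -
    have nz: "A ^ (q + 1) / B \<noteq> 0" using A0 assms(3) by simp
    have "x (A ^ (q + 1) / B) < - real q" using assms(6) unfolding vx[OF nz] by simp
    then have "real q powr real q < N (A ^ (q + 1) / B)"
      unfolding Nx[OF nz] using q_gt_1 by simp
    then show ?thesis using q_gt_1 by (simp add: powr_realpow)
  qed
  have ND: "N \<delta> ^ (q ^ 2 - q) = N A / N B"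
  proof -
    have "q \<le> q ^ 2" using q_gt_1 by (simp add: power2_eq_square)
    then have "N \<delta> ^ (q ^ 2 - q) = real q powr (- x \<delta> * (real q ^ 2 - real q))"
      using q_gt_1 assms(2) by (simp add: Nx powr_power of_nat_diff mult.commute)
    also have "\<dots> = real q powr (- x A - - x B)" using xd by simp
    also have "\<dots> = N A / N B" by (simp only: Nx A0 assms(3) powr_diff not_False_eq_True)
    finally show ?thesis .
  qed
  \<comment> \<open>The common absolute value of both coefficients after the rescaling that takes
    \<open>\<delta>\<close> to \<open>1\<close>.\<close>
  define \<sigma> where "\<sigma> = N A * N \<delta> ^ (q - 1)"
  have NB: "N B > 0" using assms(3) by simp
  have \<sigma>: "\<sigma> = N B * N \<delta> ^ (q ^ 2 - 1)"
  proof -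
    have "q ^ 2 - 1 = (q ^ 2 - q) + (q - 1)" using q_gt_1 by (simp add: power2_eq_square)
    then show ?thesis using NB by (simp add: power_add ND \<sigma>_def)
  qed
  have "real q < \<sigma>"
  proof -
    \<comment> \<open>By \<open>ND\<close>, the power \<open>\<sigma> ^ q\<close> is the absolute
      value of the j-invariant, which exceeds \<open>q ^ q\<close>.\<close>
    have "(q - 1) * q = q ^ 2 - q" by (simp add: power2_eq_square algebra_simps)
    then have "\<sigma> ^ q = N A ^ q * N \<delta> ^ (q ^ 2 - q)"
      by (simp add: \<sigma>_def power_mult_distrib flip: power_mult)
    also have "\<dots> = N (A ^ (q + 1) / B)"
      by (simp add: ND N_divide N_mult N_power)
    finally have "real q ^ q < \<sigma> ^ q" using N_quot by simp
    then show ?thesis by (rule power_less_imp_less_base) (simp add: \<sigma>_def)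
  qed
  moreover have "w ^ (q - 1) * (B * \<delta> ^ (q ^ 2 - 1)) = T"
  proof -
    have w: "w = r / \<delta> ^ (q + 1)"
      using assms(2) by (simp add: w_def assms(9) field_simps)
    have "(q + 1) * (q - 1) = q ^ 2 - 1" by (simp add: power2_eq_square algebra_simps)
    then have "w ^ (q - 1) = r ^ (q - 1) / \<delta> ^ (q ^ 2 - 1)"
      unfolding w power_divide by (simp only: flip: power_mult)
    then show ?thesis using assms(2,3) by (simp add: assms(8) del: One_nat_def)
  qed
  ultimately interpret drinfeld_period q T v A B \<delta> w e
    using assms(2,4,5) \<sigma> by unfold_locales (auto simp: \<sigma>_def)
  have F: "F = (\<lambda>n. frak_a q T e \<delta> n * w ^ (q ^ n))"
    by (simp add: F_def [abs_def])
  have fw: "f w = suminf F" by (simp add: f_def F)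
  have fw0: "f w \<noteq> 0" using N_suminf_F R_pos by (metis N_0 fw less_irrefl)
  \<comment> \<open>Maximal valuation means minimal absolute value: \<open>f w\<close> attains the
    lower bound \<open>R\<close> for nonzero periods.\<close>
  show ?thesis
    using summable_F exp_suminf_F period_lower_bound N_suminf_F fw0
    by (auto simp: F[symmetric] fw period_lattice_def v_le_iff)
qed

end
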